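(* Let $\mathbb{F}=\mathbb{R}$ or $\mathbb{C}$, let $F=\{f_i\}_{i=1}^k$ be a frame for $\mathbb{F}^n$ with $k\ge n$ and $k\geq 2$, let $H=\{h_i\}_{i=1}^k$ be a dual frame for $F$, let $G=Gr(F,H)$ be the cross-Gramian of $F$ with $H$, and let $\eta>0$. Then $$\Phi^{\eta}_{sum}(G)\ \geq\ k^2\,e^{\eta\left(\frac{n}{k^2}-\frac{n^2}{k^3}+\frac{n(k-n)}{k^3(k-1)}\right)},$$ with equality if and only if all of the following hold: (i) $H$ is the canonical dual frame for $F$; (ii) every off-diagonal entry of $G$ has the same magnitude; and (iii) every diagonal entry of $G$ has the same value.
   Context: A frame for $\mathbb{F}^n$ is a finite sequence $\{f_i\}_{i=1}^k$ ($k\ge n$) of vectors for which there are constants $0<A\le B<\infty$ with $A\|f\|^2\le\sum_{i=1}^k|\langle f,f_i\rangle|^2\le B\|f\|^2$ for all $f\in\mathbb{F}^n$ (equivalently, a spanning sequence). A dual frame for $F$ is a frame $\{h_i\}_{i=1}^k$ such that $f=\sum_{i=1}^k\langle f,h_i\rangle f_i=\sum_{i=1}^k\langle f,f_i\rangle h_i$ for all $f\in\mathbb{F}^n$. The frame operator of $F$ is $Sf=\sum_{i=1}^k\langle f,f_i\rangle f_i$, and the canonical dual frame of $F$ is $\{S^{-1}f_i\}_{i=1}^k$. The cross-Gramian is the $k\times k$ matrix $Gr(F,H)=(\langle f_i,h_j\rangle)_{i,j=1}^k$. For $\eta>0$ set $E^{\eta}_{i,j}(G)=e^{\eta|\langle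 f_i,h_j\rangle|^2}$. The off-diagonal sum potential is $\Phi^{\eta}_{od}(G)=\sum_{i=1}^k\sum_{j=1}^k(1-\delta_{i,j})E^{\eta}_{i,j}(G)$, and the sum potential is $$\Phi^{\eta}_{sum}(G)=\Phi^{\eta}_{od}(G)+\sum_{i=1}^k e^{-\eta\left(n^2/k^2-C_{k,n}^2\right)}E^{\eta}_{i,i}(G),\qquad C_{k,n}=\sqrt{\frac{nk-n^2}{k^2(k-1)}}.$$ *)

theory Defs
  imports "HOL-Analysis.Analysis"
begin

text \<open>
  The scalar field is the real or the complex numbers. Both are instances of the following class,
  and every instance is isomorphic to one of them by Gelfand--Mazur: a normed field over the reals
  is the field of real or complex numbers with the usual absolute value, and the last axiom
  determines conjugation on nonzero elements.
\<close>

class real_or_complex = real_normed_field +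
  fixes conjg :: "'a \<Rightarrow> 'a"
  assumes conjg_add: "conjg (x + y) = conjg x + conjg y"
    and conjg_mult: "conjg (x * y) = conjg x * conjg y"
    and conjg_conjg: "conjg (conjg x) = x"
    and mult_conjg: "x * conjg x = scaleR ((norm x)\<^sup>2) 1"

instantiation real :: real_or_complex
begin

definition conjg_real :: "real \<Rightarrow> real" where
  "conjg_real x = x"

instance
  by standard (simp_all add: conjg_real_def power2_eq_square)

end

instantiation complex :: real_or_complex
begin

definition conjg_complex :: "complex \<Rightarrow> complex" where
  "conjg_complex = cnj"

instance
  by standard (simp_all add: conjg_complex_def scaleR_conv_of_real complex_norm_square del: of_real_power)

end

definition scalar_prod :: "'a::real_or_complex ^ 'n \<Rightarrow> 'a ^ 'n \<Rightarrow> 'a" where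
  "scalar_prod x y = (\<Sum>l\<in>UNIV. x $ l * conjg (y $ l))"

text \<open>A sequence of \<open>k\<close> vectors is a family indexed by a type with \<open>CARD('k) = k\<close>.\<close>

definition is_frame :: "('k::finite \<Rightarrow> 'a::real_or_complex ^ 'n) \<Rightarrow> bool" where
  "is_frame f \<longleftrightarrow> CARD('n) \<le> CARD('k) \<and>
     (\<exists>A B. 0 < A \<and> A \<le> B \<and>
       (\<forall>x. A * (norm x)\<^sup>2 \<le> (\<Sum>i\<in>UNIV. (norm (scalar_prod x (f i)))\<^sup>2) \<and>
            (\<Sum>i\<in>UNIV. (norm (scalar_prod x (f i)))\<^sup>2) \<le> B * (norm x)\<^sup>2))"

definition is_dual_frame ::
  "('k::finite \<Rightarrow> 'a::real_or_complex ^ 'n) \<Rightarrow> ('k \<Rightarrow> 'a ^ 'n) \<Rightarrow> bool" where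
  "is_dual_frame f h \<longleftrightarrow> is_frame h \<and>
     (\<forall>x. x = (\<Sum>i\<in>UNIV. scalar_prod x (h i) *s f i) \<and>
          x = (\<Sum>i\<in>UNIV. scalar_prod x (f i) *s h i))"

definition frame_operator ::
  "('k::finite \<Rightarrow> 'a::real_or_complex ^ 'n) \<Rightarrow> 'a ^ 'n \<Rightarrow> 'a ^ 'n" where
  "frame_operator f x = (\<Sum>i\<in>UNIV. scalar_prod x (f i) *s f i)"

text \<open>The frame operator of a frame is bijective, so \<open>inv\<close> is its genuine inverse.\<close>

definition canonical_dual ::
  "('k::finite \<Rightarrow> 'a::real_or_complex ^ 'n) \<Rightarrow> 'k \<Rightarrow> 'a ^ 'n" where
  "canonical_dual f i = inv (frame_operator f) (f i)"

definition cross_gramian ::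
  "('k::finite \<Rightarrow> 'a::real_or_complex ^ 'n) \<Rightarrow> ('k \<Rightarrow> 'a ^ 'n) \<Rightarrow> 'a ^ 'k ^ 'k" where
  "cross_gramian f h = (\<chi> i j. scalar_prod (f i) (h j))"

definition exp_entry :: "real \<Rightarrow> 'a::real_or_complex ^ 'k ^ 'k \<Rightarrow> 'k \<Rightarrow> 'k \<Rightarrow> real" where
  "exp_entry \<eta> G i j = exp (\<eta> * (norm (G $ i $ j))\<^sup>2)"

definition od_potential :: "real \<Rightarrow> 'a::real_or_complex ^ 'k ^ 'k \<Rightarrow> real" where
  "od_potential \<eta> G =
     (\<Sum>i\<in>UNIV. \<Sum>j\<in>UNIV. (1 - (if i = j then 1 else 0)) * exp_entry \<eta> G i j)"

definition C_const :: "nat \<Rightarrow> nat \<Rightarrow> real" where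
  "C_const k n =
     sqrt ((real n * real k - (real n)\<^sup>2) / ((real k)\<^sup>2 * (real k - 1)))"

text \<open>
  The Gramian carries its size \<open>k = CARD('k)\<close> in its type, but not the dimension \<open>n\<close> of the
  underlying space, which is therefore an explicit argument.
\<close>

definition sum_potential :: "nat \<Rightarrow> real \<Rightarrow> 'a::real_or_complex ^ 'k ^ 'k \<Rightarrow> real" where
  "sum_potential n \<eta> G = od_potential \<eta> G +
     (\<Sum>i\<in>UNIV. exp (- \<eta> * ((real n)\<^sup>2 / (real CARD('k))\<^sup>2 - (C_const CARD('k) n)\<^sup>2)) *
                exp_entry \<eta> G i i)"

end

theory Submission
  imports Defs
begin

text \<open>
  The cross-Gramian \<open>G\<close> is idempotent with trace \<open>n\<close>, so
  \<open>\<parallel>G - G\<^sup>*\<parallel>\<^sup>2 = 2 \<parallel>G\<parallel>\<^sup>2 - 2 n\<close> in the Frobenius norm. Hence \<open>\<parallel>G\<parallel>\<^sup>2 \<ge> n\<close>, with equality iff \<open>G\<close> is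
  Hermitian, which happens iff the dual frame is the canonical one. The sum potential is a sum of
  \<open>k\<^sup>2\<close> exponentials, and convexity of \<open>exp\<close> bounds it below by \<open>k\<^sup>2\<close> times the exponential of the
  mean exponent, an increasing function of \<open>\<parallel>G\<parallel>\<^sup>2\<close>. Equality there means that all exponents agree;
  for a Hermitian idempotent the diagonal entries are nonnegative reals, so their absolute values
  determine them.
\<close>

section \<open>Conjugation and the scalar product over the abstract scalar field\<close>

lemma conjg_zero [simp]: "conjg (0::'a::real_or_complex) = 0"
  using conjg_add[of "0::'a" 0] by simp

lemma conjg_minus: "conjg (- x) = - conjg (x::'a::real_or_complex)"
  using conjg_add[of x "- x"] by (simp add: eq_neg_iff_add_eq_0 add.commute)

lemma conjg_diff: "conjg (x - y) = conjg x - conjg (y::'a::real_or_complex)"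
  using conjg_add[of x "- y"] by (simp add: conjg_minus)

lemma conjg_one [simp]: "conjg (1::'a::real_or_complex) = 1"
  using mult_conjg[of "1::'a"] by simp

lemma conjg_of_nat [simp]: "conjg (of_nat m :: 'a::real_or_complex) = of_nat m"
  by (induction m) (simp_all add: conjg_add)

lemma conjg_sum: "conjg (sum g A) = (\<Sum>x\<in>A. conjg (g x :: 'a::real_or_complex))"
  by (induction A rule: infinite_finite_induct) (simp_all add: conjg_add)

lemma mult_conjg_of_real: "x * conjg (x::'a::real_or_complex) = of_real ((norm x)\<^sup>2)"
  by (simp add: mult_conjg scaleR_conv_of_real)

text \<open>Expansion of \<open>z * conjg z\<close> for \<open>z = x - conjg y\<close>. The identity
  lives in the scalar field because its two cross terms need not be real separately. For
  \<open>x\<close>, \<open>y\<close> the entries at \<open>(i, j)\<close> and \<open>(j, i)\<close>,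
  they sum to the trace of the squared matrix and its conjugate.\<close>

lemma norm_conjg_diff_sq:
  fixes x y :: "'a::real_or_complex"
  shows "of_real ((norm (x - conjg y))\<^sup>2) =
    of_real ((norm x)\<^sup>2) + of_real ((norm y)\<^sup>2) - x * y - conjg (x * y)"
  unfolding mult_conjg_of_real[symmetric] conjg_diff conjg_conjg conjg_mult
  by (simp add: algebra_simps)

lemma scalar_prod_sum_left: "scalar_prod (\<Sum>i\<in>A. u i) y = (\<Sum>i\<in>A. scalar_prod (u i) y)"
  unfolding scalar_prod_def by (simp add: sum_distrib_right) (rule sum.swap)

lemma scalar_prod_scale_left: "scalar_prod (c *s x) y = c * scalar_prod x y"
  by (simp add: scalar_prod_def sum_distrib_left mult.assoc)

lemma scalar_prod_add_left: "scalar_prod (x + y) z = scalar_prod x z + scalar_prod y z"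
  by (simp add: scalar_prod_def sum.distrib algebra_simps)

lemma scalar_prod_commute: "scalar_prod y x = conjg (scalar_prod x y)"
  by (simp add: scalar_prod_def conjg_sum conjg_mult conjg_conjg mult.commute)

lemma scalar_prod_axis_left: "scalar_prod (axis m 1) y = conjg (y $ m)"
proof -
  have "scalar_prod (axis m 1) y = (\<Sum>l\<in>UNIV. if l = m then conjg (y $ l) else 0)"
    unfolding scalar_prod_def by (intro sum.cong) (auto simp: axis_def)
  then show ?thesis by simp
qed

section \<open>The frame operator and its inverse\<close>

lemma linear_frame_operator: "Vector_Spaces.linear (*s) (*s) (frame_operator f)"
  by (auto simp: Vector_Spaces.linear_iff frame_operator_def scalar_prod_add_left
      scalar_prod_scale_left vec.scale_left_distrib sum.distrib vec.scale_sum_right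
      vector_smult_assoc intro!: vec.vector_space_axioms)

lemma scalar_prod_frame_operator:
  "scalar_prod (frame_operator f x) y =
     (\<Sum>i\<in>UNIV. scalar_prod x (f i) * conjg (scalar_prod y (f i)))"
  unfolding frame_operator_def scalar_prod_sum_left scalar_prod_scale_left
  by (subst scalar_prod_commute[of _ y]) (rule refl)

text \<open>If the operator kills \<open>x\<close>, then its scalar product with \<open>x\<close>,
  which is the frame sum of \<open>x\<close>, vanishes; the lower frame bound forces
  \<open>x = 0\<close>.\<close>

lemma inj_frame_operator:
  assumes "is_frame f"
  shows "inj (frame_operator f)"
proof -
  from assms obtain A where A: "0 < A"
    "\<And>x. A * (norm x)\<^sup>2 \<le> (\<Sum>i\<in>UNIV. (norm (scalar_prod x (f i)))\<^sup>2)"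
    unfolding is_frame_def by blast
  have "x = 0" if "frame_operator f x = 0" for x
  proof -
    have "of_real (\<Sum>i\<in>UNIV. (norm (scalar_prod x (f i)))\<^sup>2) = scalar_prod (frame_operator f x) x"
      by (simp only: scalar_prod_frame_operator mult_conjg_of_real of_real_sum)
    also have "\<dots> = 0" using that by (simp add: scalar_prod_def)
    finally have "A * (norm x)\<^sup>2 \<le> 0" using A(2)[of x] by (simp only: of_real_eq_0_iff)
    with A(1) show "x = 0" by (simp add: mult_le_0_iff)
  qed
  then show ?thesis
    using vec.linear_inj_iff_eq_0[OF linear_frame_operator[of f]] by blast
qed

text \<open>In finite dimension the injective operator is also surjective, so \<open>inv\<close> is
  a right inverse.\<close>

lemma frame_operator_canonical_dual:
  assumes "is_frame f"
  shows "frame_operator f (canonical_dual f i) = f i"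
proof -
  have "surj (frame_operator f)"
    using vec.linear_inj_imp_surj[OF linear_frame_operator inj_frame_operator[OF assms]] by simp
  then show ?thesis by (simp add: canonical_dual_def surj_f_inv_f)
qed

section \<open>The cross-Gramian as an idempotent of trace n\<close>

lemma dual_frame_expansion:
  assumes "is_dual_frame f h"
  shows "x = (\<Sum>i\<in>UNIV. scalar_prod x (h i) *s f i)"
  using assms unfolding is_dual_frame_def by blast

text \<open>Expand \<open>f i\<close> by the dual frame and take the scalar product with
  \<open>h l\<close>.\<close>

lemma cross_gramian_idem:
  assumes "is_dual_frame f h"
  shows "(\<Sum>j\<in>UNIV. cross_gramian f h $ i $ j * cross_gramian f h $ j $ l) =
    cross_gramian f h $ i $ l"
proof -
  have "cross_gramian f h $ i $ l =
      scalar_prod (\<Sum>j\<in>UNIV. scalar_prod (f i) (h j) *s f j) (h l)"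
    unfolding dual_frame_expansion[OF assms, of "f i", symmetric] by (simp add: cross_gramian_def)
  then show ?thesis
    by (simp add: cross_gramian_def scalar_prod_sum_left scalar_prod_scale_left)
qed

lemma cross_gramian_trace:
  fixes f h :: "'k::finite \<Rightarrow> 'a::real_or_complex ^ 'n"
  assumes "is_dual_frame f h"
  shows "(\<Sum>i\<in>UNIV. cross_gramian f h $ i $ i) = of_nat CARD('n)"
proof -
  \<comment> \<open>The m-th coordinate of the expansion of the m-th basis vector. Swapping sums
    turns the trace into n of these.\<close>
  have *: "(\<Sum>i\<in>UNIV. f i $ m * conjg (h i $ m)) = 1" for m
  proof -
    have "(axis m 1 :: 'a ^ 'n) $ m = (\<Sum>i\<in>UNIV. scalar_prod (axis m 1) (h i) *s f i) $ m"
      using dual_frame_expansion[OF assms, of "axis m 1"] by (rule arg_cong)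
    then show ?thesis by (simp add: scalar_prod_axis_left mult.commute)
  qed
  have "(\<Sum>i\<in>UNIV. cross_gramian f h $ i $ i) = (\<Sum>m\<in>UNIV. \<Sum>i\<in>UNIV. f i $ m * conjg (h i $ m))"
    unfolding cross_gramian_def scalar_prod_def by (simp, rule sum.swap)
  then show ?thesis by (simp add: *)
qed

lemma cross_gramian_hermitian_defect:
  fixes f h :: "'k::finite \<Rightarrow> 'a::real_or_complex ^ 'n"
  assumes "is_dual_frame f h"
  defines "G \<equiv> cross_gramian f h"
  shows "(\<Sum>i\<in>UNIV. \<Sum>j\<in>UNIV. (norm (G $ i $ j - conjg (G $ j $ i)))\<^sup>2) =
    2 * (\<Sum>i\<in>UNIV. \<Sum>j\<in>UNIV. (norm (G $ i $ j))\<^sup>2) - 2 * real CARD('n)"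
proof -
  \<comment> \<open>Idempotence collapses the inner sum to a diagonal entry, which leaves the
    trace.\<close>
  have tr: "(\<Sum>i\<in>UNIV. \<Sum>j\<in>UNIV. G $ i $ j * G $ j $ i) = of_nat CARD('n)"
    unfolding G_def by (simp add: cross_gramian_idem[OF assms(1)] cross_gramian_trace[OF assms(1)])
  have tr': "(\<Sum>i\<in>UNIV. \<Sum>j\<in>UNIV. conjg (G $ i $ j * G $ j $ i)) = of_nat CARD('n)"
    using arg_cong[OF tr, of conjg] by (simp add: conjg_sum)
  have sw: "(\<Sum>i\<in>UNIV. \<Sum>j\<in>UNIV. (of_real ((norm (G $ j $ i))\<^sup>2) :: 'a)) =
      (\<Sum>i\<in>UNIV. \<Sum>j\<in>UNIV. of_real ((norm (G $ i $ j))\<^sup>2))"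
    by (rule sum.swap)
  have "of_real (\<Sum>i\<in>UNIV. \<Sum>j\<in>UNIV. (norm (G $ i $ j - conjg (G $ j $ i)))\<^sup>2) =
      (of_real (2 * (\<Sum>i\<in>UNIV. \<Sum>j\<in>UNIV. (norm (G $ i $ j))\<^sup>2) - 2 * real CARD('n)) :: 'a)"
    unfolding of_real_sum norm_conjg_diff_sq sum.distrib sum_subtractf tr tr' sw
      of_real_diff of_real_mult by simp
  then show ?thesis by (simp only: of_real_eq_iff)
qed

lemma cross_gramian_norm_ge:
  fixes f h :: "'k::finite \<Rightarrow> 'a::real_or_complex ^ 'n"
  assumes "is_dual_frame f h"
  shows "real CARD('n) \<le> (\<Sum>i\<in>UNIV. \<Sum>j\<in>UNIV. (norm (cross_gramian f h $ i $ j))\<^sup>2)"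
proof -
  have "0 \<le> (\<Sum>i\<in>UNIV. \<Sum>j\<in>UNIV.
      (norm (cross_gramian f h $ i $ j - conjg (cross_gramian f h $ j $ i)))\<^sup>2)"
    by (intro sum_nonneg) simp
  then show ?thesis using cross_gramian_hermitian_defect[OF assms] by linarith
qed

lemma cross_gramian_norm_eq_iff_hermitian:
  fixes f h :: "'k::finite \<Rightarrow> 'a::real_or_complex ^ 'n"
  assumes "is_dual_frame f h"
  shows "(\<Sum>i\<in>UNIV. \<Sum>j\<in>UNIV. (norm (cross_gramian f h $ i $ j))\<^sup>2) = real CARD('n) \<longleftrightarrow>
    (\<forall>i j. cross_gramian f h $ i $ j = conjg (cross_gramian f h $ j $ i))"
proof -
  have "(\<Sum>i\<in>UNIV. \<Sum>j\<in>UNIV. (norm (cross_gramian f h $ i $ j))\<^sup>2) = real CARD('n) \<longleftrightarrow>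
    (\<Sum>i\<in>UNIV. \<Sum>j\<in>UNIV.
      (norm (cross_gramian f h $ i $ j - conjg (cross_gramian f h $ j $ i)))\<^sup>2) = 0"
    using cross_gramian_hermitian_defect[OF assms] by linarith
  then show ?thesis by (simp add: sum_nonneg_eq_0_iff sum_nonneg)
qed

text \<open>With S the frame operator, symmetry turns the dual expansion of \<open>f i\<close> into
  S applied to \<open>h i\<close>, so S maps \<open>h i\<close> to \<open>f i\<close>, and
  injectivity identifies \<open>h i\<close>. Conversely, if S maps each \<open>h i\<close> to
  \<open>f i\<close>, the entries are scalar products of S \<open>h i\<close> with
  \<open>h j\<close>, and S is self-adjoint.\<close>

lemma hermitian_cross_gramian_iff:
  fixes f h :: "'k::finite \<Rightarrow> 'a::real_or_complex ^ 'n"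
  assumes "is_frame f" "is_dual_frame f h"
  shows "(\<forall>i j. cross_gramian f h $ i $ j = conjg (cross_gramian f h $ j $ i)) \<longleftrightarrow>
    h = canonical_dual f"
proof
  assume herm: "\<forall>i j. cross_gramian f h $ i $ j = conjg (cross_gramian f h $ j $ i)"
  show "h = canonical_dual f"
  proof
    fix i
    have "scalar_prod (f i) (h j) = scalar_prod (h i) (f j)" for j
      using herm[rule_format, of i j] scalar_prod_commute[of "h i" "f j"]
      unfolding cross_gramian_def by simp
    then have "frame_operator f (h i) = f i"
      unfolding frame_operator_def using dual_frame_expansion[OF assms(2), of "f i", symmetric] by simp
    then show "h i = canonical_dual f i"
      using inj_frame_operator[OF assms(1)] frame_operator_canonical_dual[OF assms(1), of i]
      by (metis injD)
  qed
next
  assume "h = canonical_dual f"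
  have S: "frame_operator f (h i) = f i" for i
    unfolding \<open>h = canonical_dual f\<close> by (rule frame_operator_canonical_dual[OF assms(1)])
  have "scalar_prod (frame_operator f (h i)) (h j) =
      conjg (scalar_prod (frame_operator f (h j)) (h i))" for i j
    by (simp add: scalar_prod_frame_operator conjg_sum conjg_mult conjg_conjg mult.commute)
  then have "scalar_prod (f i) (h j) = conjg (scalar_prod (f j) (h i))" for i j
    unfolding S .
  then show "\<forall>i j. cross_gramian f h $ i $ j = conjg (cross_gramian f h $ j $ i)"
    unfolding cross_gramian_def vec_lambda_beta by blast
qed

section \<open>Convexity of exp, and the potential as a single sum of exponentials\<close>

lemma sum_exp_ge_mean:
  fixes x :: "'b \<Rightarrow> real"
  assumes "finite A" and "sum x A = real (card A) * m"
  shows "real (card A) * exp m \<le> (\<Sum>a\<in>A. exp (x a))" (is ?ge)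
    and "(\<Sum>a\<in>A. exp (x a)) = real (card A) * exp m \<longleftrightarrow> (\<forall>a\<in>A. x a = m)" (is ?eq)
proof -
  \<comment> \<open>The gap between exp and its tangent at the mean, up to the factor
    \<open>exp m\<close>. The linear terms cancel on summation, so the total excess is
    \<open>exp m * sum d A\<close>.\<close>
  define d where "d a = exp (x a - m) - 1 - (x a - m)" for a
  have d: "0 \<le> d a" for a
    using exp_ge_add_one_self[of "x a - m"] unfolding d_def by linarith
  \<comment> \<open>A zero gap says that \<open>ln y = y - 1\<close> for
    \<open>y = exp (x a - m)\<close>, which forces \<open>y = 1\<close>.\<close>
  have d0: "d a = 0 \<longleftrightarrow> x a = m" for a
    using ln_eq_minus_one[of "exp (x a - m)"] by (auto simp: d_def)
  have "exp (x a) = exp m * (d a + 1 + (x a - m))" for a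
    by (simp add: d_def mult_exp_exp)
  then have "(\<Sum>a\<in>A. exp (x a)) = exp m * (sum d A + real (card A) + (sum x A - real (card A) * m))"
    by (simp add: sum_distrib_left[symmetric] sum.distrib sum_subtractf)
  then have eq: "(\<Sum>a\<in>A. exp (x a)) = exp m * sum d A + real (card A) * exp m"
    using assms(2) by (simp add: algebra_simps)
  show ?ge using eq d by (simp add: sum_nonneg)
  show ?eq using eq d d0 assms(1) by (simp add: sum_nonneg_eq_0_iff)
qed

text \<open>The diagonal weight is itself an exponential, so it becomes a shift of the diagonal
  exponents.\<close>

lemma sum_potential_eq_sum_exp:
  fixes G :: "'a::real_or_complex ^ 'k::finite ^ 'k"
  shows "sum_potential n \<eta> G = (\<Sum>(i, j)\<in>UNIV. exp (\<eta> * ((norm (G $ i $ j))\<^sup>2 -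
    (if i = j then (real n)\<^sup>2 / (real CARD('k))\<^sup>2 - (C_const CARD('k) n)\<^sup>2 else 0))))"
    (is "_ = (\<Sum>(i, j)\<in>UNIV. exp (\<eta> * (?g i j - (if i = j then ?D else 0))))")
proof -
  have "sum_potential n \<eta> G = (\<Sum>i\<in>UNIV. \<Sum>j\<in>UNIV. (1 - (if i = j then 1 else 0)) * exp (\<eta> * ?g i j) +
      (if i = j then exp (- \<eta> * ?D) * exp (\<eta> * ?g i j) else 0))"
    unfolding sum_potential_def od_potential_def exp_entry_def
    by (simp only: sum.distrib sum.delta' sum.delta finite UNIV_I if_True)
  also have "\<dots> = (\<Sum>i\<in>UNIV. \<Sum>j\<in>UNIV. exp (\<eta> * (?g i j - (if i = j then ?D else 0))))"
    by (intro sum.cong refl) (simp add: mult_exp_exp algebra_simps)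
  finally show ?thesis
    by (simp only: sum.cartesian_product UNIV_Times_UNIV)
qed

lemma C_const_sq:
  assumes "n \<le> k" "1 \<le> k"
  shows "(C_const k n)\<^sup>2 = real n * (real k - real n) / ((real k)\<^sup>2 * (real k - 1))"
proof -
  have "real n * real n \<le> real n * real k" using assms by (intro mult_left_mono) auto
  then have "0 \<le> (real n * real k - (real n)\<^sup>2) / ((real k)\<^sup>2 * (real k - 1))"
    using assms by (intro divide_nonneg_nonneg mult_nonneg_nonneg) (auto simp: power2_eq_square)
  then show ?thesis
    unfolding C_const_def by (simp only: real_sqrt_pow2) (simp add: power2_eq_square right_diff_distrib)
qed

section \<open>The lower bound and its equality case\<close>

theorem proposition38:
  fixes f h :: "'k::finite \<Rightarrow> 'a::real_or_complex ^ 'n"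
    and G :: "'a ^ 'k ^ 'k"
    and \<eta> :: real
    and n k :: nat
  assumes "n = CARD('n)" and "k = CARD('k)"
    and "n \<le> k" and "2 \<le> k"
    and "is_frame f"
    and "is_dual_frame f h"
    and "G = cross_gramian f h"
    and "0 < \<eta>"
  shows "real k ^ 2 * exp (\<eta> * (real n / real k ^ 2 - real n ^ 2 / real k ^ 3 +
             real n * (real k - real n) / (real k ^ 3 * (real k - 1))))
           \<le> sum_potential n \<eta> G \<and>
         (sum_potential n \<eta> G =
            real k ^ 2 * exp (\<eta> * (real n / real k ^ 2 - real n ^ 2 / real k ^ 3 +
              real n * (real k - real n) / (real k ^ 3 * (real k - 1)))) \<longleftrightarrow>
          h = canonical_dual f \<and>
          (\<exists>c. \<forall>i j. i \<noteq> j \<longrightarrow> norm (G $ i $ j) = c) \<and>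
          (\<exists>d. \<forall>i. G $ i $ i = d))"
proof -
  define D where "D = (real n)\<^sup>2 / (real k)\<^sup>2 - (C_const k n)\<^sup>2"
  define x where "x = (\<lambda>(i, j). \<eta> * ((norm (G $ i $ j))\<^sup>2 - (if i = j then D else 0)))"
  define N where "N = (\<Sum>i\<in>UNIV. \<Sum>j\<in>UNIV. (norm (G $ i $ j))\<^sup>2)"
  define m where "m = \<eta> * (N - real k * D) / (real k)\<^sup>2"
  define L where "L = \<eta> * (real n / real k ^ 2 - real n ^ 2 / real k ^ 3 +
             real n * (real k - real n) / (real k ^ 3 * (real k - 1)))"
  have k: "0 < real k" "0 < real k - 1" using assms(4) by auto
  have C: "(C_const k n)\<^sup>2 = real n * (real k - real n) / ((real k)\<^sup>2 * (real k - 1))"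
    using assms(3,4) by (intro C_const_sq) auto
  have card: "real (card (UNIV :: ('k \<times> 'k) set)) = (real k)\<^sup>2"
    using assms(2) by (simp add: power2_eq_square)
  have pot: "sum_potential n \<eta> G = (\<Sum>p\<in>UNIV. exp (x p))"
    unfolding sum_potential_eq_sum_exp x_def D_def assms(2)
    by (intro sum.cong) (auto simp: case_prod_unfold)
  have "sum x UNIV = (\<Sum>i\<in>UNIV. \<Sum>j\<in>UNIV. \<eta> * ((norm (G $ i $ j))\<^sup>2 - (if i = j then D else 0)))"
    unfolding x_def by (simp only: sum.cartesian_product UNIV_Times_UNIV)
  also have "\<dots> = \<eta> * (N - real k * D)"
    unfolding N_def using assms(2) by (simp add: sum_distrib_left[symmetric] sum_subtractf)
  finally have mean: "sum x UNIV = real (card (UNIV :: ('k \<times> 'k) set)) * m"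
    unfolding card m_def using k by simp
  \<comment> \<open>The exponent of the bound is the mean exponent \<open>m\<close> with
    \<open>N\<close> replaced by its lower bound n.\<close>
  have L: "L = \<eta> * (real n - real k * D) / (real k)\<^sup>2"
    unfolding L_def D_def C using k by (simp add: field_simps power2_eq_square power3_eq_cube)
  have "real n \<le> N"
    using cross_gramian_norm_ge[OF assms(6)] assms(1,7) unfolding N_def by simp
  then have "L \<le> m"
    unfolding L m_def using assms(8) k by (intro divide_right_mono mult_left_mono) auto
  have m_eq: "m = L \<longleftrightarrow> N = real n"
    unfolding L m_def using assms(8) k by simp
  note jensen = sum_exp_ge_mean[OF finite mean, unfolded card, folded pot]
  have LM: "(real k)\<^sup>2 * exp L \<le> (real k)\<^sup>2 * exp m"
    using \<open>L \<le> m\<close> by (intro mult_left_mono) auto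
  \<comment> \<open>The bound is a chain of two inequalities, so equality holds iff it holds in both
    links.\<close>
  have "sum_potential n \<eta> G = (real k)\<^sup>2 * exp L \<longleftrightarrow>
      sum_potential n \<eta> G = (real k)\<^sup>2 * exp m \<and> (real k)\<^sup>2 * exp m = (real k)\<^sup>2 * exp L"
    using LM jensen(1) by linarith
  also have "\<dots> \<longleftrightarrow> (\<forall>p. x p = m) \<and> N = real n"
    using jensen(2) m_eq k by simp
  finally have pot_eq: "sum_potential n \<eta> G = (real k)\<^sup>2 * exp L \<longleftrightarrow> (\<forall>p. x p = m) \<and> N = real n" .
  have can: "N = real n \<longleftrightarrow> h = canonical_dual f"
    unfolding N_def assms(1,7) cross_gramian_norm_eq_iff_hermitian[OF assms(6)]
    by (rule hermitian_cross_gramian_iff[OF assms(5,6)])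
  have "(\<forall>p. x p = m) \<longleftrightarrow> (\<exists>c. \<forall>i j. i \<noteq> j \<longrightarrow> norm (G $ i $ j) = c) \<and> (\<exists>d. \<forall>i. G $ i $ i = d)"
    if Nn: "N = real n"
  proof
    assume "\<forall>p. x p = m"
    then have x: "(norm (G $ i $ j))\<^sup>2 - (if i = j then D else 0) = m / \<eta>" for i j
      using assms(8) by (force simp: x_def field_simps)
    have "norm (G $ i $ j) = sqrt (m / \<eta>)" if "i \<noteq> j" for i j
      using x[of i j] that by (simp add: real_sqrt_unique)
    moreover have "G $ i $ i = of_real (sqrt (m / \<eta> + D))" for i
    proof -
      have herm: "G $ j $ i = conjg (G $ i $ j)" for j
        using Nn cross_gramian_norm_eq_iff_hermitian[OF assms(6)]
        unfolding N_def assms(1,7) by blast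
      \<comment> \<open>By idempotence and symmetry the diagonal entry is the squared norm of its
        row, hence a nonnegative real.\<close>
      have "G $ i $ i = (\<Sum>j\<in>UNIV. G $ i $ j * G $ j $ i)"
        unfolding assms(7) cross_gramian_idem[OF assms(6)] ..
      also have "\<dots> = of_real (\<Sum>j\<in>UNIV. (norm (G $ i $ j))\<^sup>2)"
        unfolding of_real_sum by (intro sum.cong refl) (subst herm, rule mult_conjg_of_real)
      finally obtain r where r: "G $ i $ i = of_real r" "0 \<le> r"
        by (metis sum_nonneg zero_le_power2)
      then have "r\<^sup>2 = m / \<eta> + D" using x[of i i] by simp
      with r show ?thesis by (simp add: real_sqrt_unique)
    qed
    ultimately show "(\<exists>c. \<forall>i j. i \<noteq> j \<longrightarrow> norm (G $ i $ j) = c) \<and> (\<exists>d. \<forall>i. G $ i $ i = d)"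
      by blast
  next
    assume "(\<exists>c. \<forall>i j. i \<noteq> j \<longrightarrow> norm (G $ i $ j) = c) \<and> (\<exists>d. \<forall>i. G $ i $ i = d)"
    then obtain c d where c: "\<And>i j. i \<noteq> j \<Longrightarrow> norm (G $ i $ j) = c" and d: "\<And>i. G $ i $ i = d"
      by blast
    \<comment> \<open>The trace fixes the diagonal magnitude as n/k; counting k diagonal and k(k-1)
      off-diagonal entries in \<open>N = real n\<close> then fixes \<open>c\<close>.\<close>
    have "of_nat k * d = of_nat n"
      using cross_gramian_trace[OF assms(6)] assms(1,2,7) d by simp
    then have "real k * norm d = real n" by (metis norm_mult norm_of_nat)
    then have d': "norm d = real n / real k" using k by (simp add: field_simps)
    have "N = (\<Sum>i\<in>(UNIV::'k set). \<Sum>j\<in>(UNIV::'k set). c\<^sup>2 + (if i = j then (norm d)\<^sup>2 - c\<^sup>2 else 0))"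
      unfolding N_def by (intro sum.cong refl) (auto simp: c d)
    also have "\<dots> = real k * (real k * c\<^sup>2 + ((norm d)\<^sup>2 - c\<^sup>2))"
      using assms(2) by (simp add: sum.distrib)
    finally have "real k * (real k - 1) * c\<^sup>2 = real n - real k * (real n / real k)\<^sup>2"
      unfolding Nn d' by (simp add: algebra_simps)
    then have "c\<^sup>2 = (real n - real k * (real n / real k)\<^sup>2) / (real k * (real k - 1))"
      using k by (simp add: eq_divide_eq mult.commute)
    also have "\<dots> = (C_const k n)\<^sup>2"
      unfolding C using k by (simp add: divide_simps) (simp add: algebra_simps power2_eq_square)
    finally have c2: "c\<^sup>2 = (C_const k n)\<^sup>2" .
    \<comment> \<open>The shift \<open>D\<close> is chosen so that a squared diagonal magnitude of
      n^2/k^2 leaves the same exponent as an off-diagonal entry. A constant family equals its mean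
      \<open>m\<close>.\<close>
    have xp: "x p = \<eta> * (C_const k n)\<^sup>2" for p
      using c2 d' by (cases p) (auto simp: x_def c d D_def power_divide)
    then have "(real k)\<^sup>2 * m = (real k)\<^sup>2 * (\<eta> * (C_const k n)\<^sup>2)"
      using mean card by simp
    then show "\<forall>p. x p = m" using xp k by simp
  qed
  then have "sum_potential n \<eta> G = (real k)\<^sup>2 * exp L \<longleftrightarrow> h = canonical_dual f \<and>
      (\<exists>c. \<forall>i j. i \<noteq> j \<longrightarrow> norm (G $ i $ j) = c) \<and> (\<exists>d. \<forall>i. G $ i $ i = d)"
    unfolding pot_eq can by blast
  with order_trans[OF LM jensen(1)] show ?thesis
    unfolding L_def by (rule conjI)
qed

end
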